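(* Let $F$ be a two-dimensional lattice. Suppose there exist $w^*\in S_{F^*}^+$ and $\delta>0$ such that $F$ denies the positive Daugavet property with $S(B_F,w^*,\delta)\cap S_F^+$. Then $X_1\oplus_F X_2$ is not a Daugavet domain for any Banach spaces $X_1$ and $X_2$.
   Context: All Banach spaces are real and different from $\{0\}$. A nonzero continuous linear operator $G:X\to Y$ between Banach spaces is a Daugavet center if every (bounded) rank-1 operator $T:X\to Y$ satisfies $\|G+T\|=\|G\|+\|T\|$. A Banach space $X$ is a Daugavet domain if there exist a Banach space $Y$ and a Daugavet center $G:X\to Y$. A two-dimensional lattice is a space $F=(\mathbb{R}^2,\|\cdot\|)$, where the norm satisfies $\|(1,0)\|=\|(0,1)\|=1$ and $\|(a_1,a_2)\|=\|(|a_1|,|a_2|)\|$ for all $(a_1,a_2)$, ordered coordinatewise. Its dual $F^*$ is $\mathbb{R}^2$ with $\|(f_1,f_2)\|_{F^*}=\max_{(a_1,a_2)\in B_F}|f_1a_1+f_2a_2|$ and is again a two-dimensional lattice. $B_F$ is the closed unit ball, $S_F^+=\{a\in F:\|a\|=1,\ a\ge 0\}$, and similarly $S_{F^*}^+$. For $f^*\in S_{F^*}$, $\varepsilon>0$: $S(B_F,f^*,\varepsilon)=\{a\in B_F: f^*(a)>1-\varepsilon\}$. For Banach spaces $X_1,X_2$, $X_1\oplus_F X_2$ is the space of pairs $(x_1,x_2)$, $x_i\in X_i$, with norm $\|(x_1,x_2)\|=\|(\|x_1\|,\|x_2\|)\|_F$. $F$ denies the positive Daugavet property with $A\subset S_F^+$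 if there is an $\varepsilon>0$ such that for every $a\in A$ there exists an $f^*\in S_{F^*}^+$ satisfying $\|\mathrm{Id}+f^*\otimes a\|<2-\varepsilon$, where $f^*\otimes a$ is the operator $b\mapsto f^*(b)a$ on $F$. *)

theory Defs
  imports "HOL-Analysis.Analysis"
begin

text \<open>
  The norm of an absolute sum \<open>X\<^sub>1 \<oplus>\<^sub>F X\<^sub>2\<close> depends on the norm of \<open>F\<close>, so it cannot be the class
  norm of a type. A norm on a real vector space that is not the class norm is therefore passed
  explicitly as a function.
\<close>

definition is_norm :: "('a::real_vector \<Rightarrow> real) \<Rightarrow> bool" where
  "is_norm N \<longleftrightarrow>
     (\<forall>x. 0 \<le> N x) \<and> (\<forall>x. N x = 0 \<longleftrightarrow> x = 0) \<and>
     (\<forall>c x. N (c *\<^sub>R x) = \<bar>c\<bar> * N x) \<and>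
     (\<forall>x y. N (x + y) \<le> N x + N y)"

definition bounded_operator ::
    "('x::real_vector \<Rightarrow> real) \<Rightarrow> ('y::real_vector \<Rightarrow> real) \<Rightarrow> ('x \<Rightarrow> 'y) \<Rightarrow> bool" where
  "bounded_operator NX NY T \<longleftrightarrow> linear T \<and> (\<exists>K. \<forall>x. NY (T x) \<le> K * NX x)"

text \<open>Meaningful for bounded operators only: the supremum of an unbounded set is unspecified.\<close>

definition opnorm ::
    "('x::real_vector \<Rightarrow> real) \<Rightarrow> ('y::real_vector \<Rightarrow> real) \<Rightarrow> ('x \<Rightarrow> 'y) \<Rightarrow> real" where
  "opnorm NX NY T = (SUP x\<in>{x. NX x \<le> 1}. NY (T x))"

definition daugavet_center :: "('x::real_vector \<Rightarrow> real) \<Rightarrow> ('x \<Rightarrow> 'y::banach) \<Rightarrow> bool" where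
  "daugavet_center NX G \<longleftrightarrow>
     bounded_operator NX norm G \<and> G \<noteq> (\<lambda>_. 0) \<and>
     (\<forall>T::'x \<Rightarrow> 'y. bounded_operator NX norm T \<and> dim (range T) = 1 \<longrightarrow>
        opnorm NX norm (\<lambda>x. G x + T x) = opnorm NX norm G + opnorm NX norm T)"

text \<open>
  HOL has no quantification over types, so the target space \<open>Y\<close> is a type parameter. A Banach space
  fails to be a Daugavet domain if the negation of this predicate holds with a free type variable
  \<open>'y\<close>, i.e. for all Banach spaces \<open>Y\<close>. That \<open>Y \<noteq> {0}\<close> follows from \<open>G \<noteq> 0\<close>.
\<close>

definition daugavet_domain_into :: "'y::banach itself \<Rightarrow> ('x::real_vector \<Rightarrow> real) \<Rightarrow> bool" where
  "daugavet_domain_into (_ :: 'y itself) NX \<longleftrightarrow> (\<exists>G::'x \<Rightarrow> 'y. daugavet_center NX G)"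

definition two_dim_lattice :: "(real \<times> real \<Rightarrow> real) \<Rightarrow> bool" where
  "two_dim_lattice F \<longleftrightarrow>
     is_norm F \<and> F (1, 0) = 1 \<and> F (0, 1) = 1 \<and>
     (\<forall>a\<^sub>1 a\<^sub>2. F (a\<^sub>1, a\<^sub>2) = F (\<bar>a\<^sub>1\<bar>, \<bar>a\<^sub>2\<bar>))"

text \<open>
  The functional \<open>(f\<^sub>1, f\<^sub>2)\<close> acts by \<open>f\<^sub>1 * a\<^sub>1 + f\<^sub>2 * a\<^sub>2\<close>, the inner product of the type
  \<^typ>\<open>real \<times> real\<close>.
\<close>

definition dual_norm :: "(real \<times> real \<Rightarrow> real) \<Rightarrow> real \<times> real \<Rightarrow> real" where
  "dual_norm F f = (SUP a\<in>{a. F a \<le> 1}. \<bar>f \<bullet> a\<bar>)"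

definition pos_sphere :: "(real \<times> real \<Rightarrow> real) \<Rightarrow> (real \<times> real) set" where
  "pos_sphere F = {a. F a = 1 \<and> 0 \<le> fst a \<and> 0 \<le> snd a}"

definition slice :: "(real \<times> real \<Rightarrow> real) \<Rightarrow> real \<times> real \<Rightarrow> real \<Rightarrow> (real \<times> real) set" where
  "slice F f \<epsilon> = {a. F a \<le> 1 \<and> f \<bullet> a > 1 - \<epsilon>}"

definition denies_positive_daugavet ::
    "(real \<times> real \<Rightarrow> real) \<Rightarrow> (real \<times> real) set \<Rightarrow> bool" where
  "denies_positive_daugavet F A \<longleftrightarrow>
     (\<exists>\<epsilon>>0. \<forall>a\<in>A. \<exists>f\<in>pos_sphere (dual_norm F).
        opnorm F F (\<lambda>b. b + (f \<bullet> b) *\<^sub>R a) < 2 - \<epsilon>)"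

definition sum_norm ::
    "(real \<times> real \<Rightarrow> real) \<Rightarrow> 'a::real_normed_vector \<times> 'b::real_normed_vector \<Rightarrow> real" where
  "sum_norm F x = F (norm (fst x), norm (snd x))"

end

theory Submission
  imports Defs
begin

text \<open>
  Suppose \<open>G\<close> were a Daugavet center and let \<open>w\<close>, \<open>\<delta>\<close>, \<open>\<epsilon>\<close> be as in the hypothesis. Norm-one
  functionals \<open>\<phi>\<^sub>1\<close>, \<open>\<phi>\<^sub>2\<close> on the summands turn every \<open>f\<close> in the positive dual sphere into a
  norm-one functional \<open>f\<^sub>1 \<phi>\<^sub>1 + f\<^sub>2 \<phi>\<^sub>2\<close> on the sum. Applying the Daugavet equation to the operator
  given by \<open>w\<close> yields a unit vector \<open>x\<close> on which \<open>G\<close> almost attains its norm and whose pair of norms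
  \<open>a = (\<parallel>x\<^sub>1\<parallel>, \<parallel>x\<^sub>2\<parallel>)\<close> lies in the slice of \<open>w\<close>. With \<open>f\<close> chosen for this \<open>a\<close> and \<open>\<phi>\<close> induced by
  \<open>f\<close>, the operator \<open>G + \<phi> \<otimes> G x = G \<circ> (Id + \<phi> \<otimes> x)\<close> has norm at most \<open>\<parallel>G\<parallel> \<parallel>Id + f \<otimes> a\<parallel>\<close>, which
  is below \<open>(2 - \<epsilon>) \<parallel>G\<parallel>\<close>, whereas the Daugavet equation makes it almost \<open>2 \<parallel>G\<parallel>\<close>.
\<close>

section \<open>Norming functionals\<close>

text \<open>Homogeneity is asked only as an inequality, which is easier to check for infima;
  equality follows by scaling back with \<open>inverse c\<close>. The bound by the norm also yields
  \<open>- norm x\<close> as a lower bound, so that pointwise infima exist.\<close>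

definition norm_sublinear :: "('a::real_normed_vector \<Rightarrow> real) \<Rightarrow> bool" where
  "norm_sublinear p \<longleftrightarrow> (\<forall>x y. p (x + y) \<le> p x + p y) \<and> (\<forall>c\<ge>0. \<forall>x. p (c *\<^sub>R x) \<le> c * p x) \<and>
     (\<forall>x. p x \<le> norm x)"

lemma norm_sublinearD:
  assumes "norm_sublinear p"
  shows "p (x + y) \<le> p x + p y" and "0 \<le> c \<Longrightarrow> p (c *\<^sub>R x) = c * p x"
    and "p x \<le> norm x" and "- p (- x) \<le> p x" and "- norm x \<le> p x"
proof -
  show sub: "p (x + y) \<le> p x + p y" for x y
    using assms by (simp add: norm_sublinear_def)
  have le: "p (c *\<^sub>R x) \<le> c * p x" if "0 \<le> c" for c x
    using assms that by (simp add: norm_sublinear_def)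
  show nrm: "p x \<le> norm x" for x
    using assms by (simp add: norm_sublinear_def)
  have "p 0 = 0"
    using sub[of 0 0] le[of 0 0] by simp
  then show neg: "- p (- x) \<le> p x" for x
    using sub[of x "- x"] by simp
  show "- norm x \<le> p x"
    using neg[of x] nrm[of "- x"] by simp
  show "p (c *\<^sub>R x) = c * p x" if "0 \<le> c"
  proof (cases "c = 0")
    case False
    then have "p x \<le> inverse c * p (c *\<^sub>R x)"
      using that le[of "inverse c" "c *\<^sub>R x"] by simp
    with False that le[of c x] show ?thesis
      by (simp add: field_simps)
  qed (simp add: \<open>p 0 = 0\<close>)
qed

text \<open>This is the largest sublinear functional below \<open>p\<close> whose value at
  \<open>- z\<close> is at most \<open>- p z\<close>. If it equals \<open>p\<close>, then
  \<open>p\<close> is additive in the direction \<open>z\<close>.\<close>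

definition sublinear_shift :: "('a::real_normed_vector \<Rightarrow> real) \<Rightarrow> 'a \<Rightarrow> 'a \<Rightarrow> real" where
  "sublinear_shift p z x = (INF t\<in>{0..}. p (x + t *\<^sub>R z) - t * p z)"

lemma sublinear_shift_le:
  assumes "norm_sublinear p" "0 \<le> t"
  shows "sublinear_shift p z x \<le> p (x + t *\<^sub>R z) - t * p z"
  unfolding sublinear_shift_def
proof (rule cINF_lower)
  show "bdd_below ((\<lambda>t. p (x + t *\<^sub>R z) - t * p z) ` {0..})"
  \<comment> \<open>The lower bound comes from splitting \<open>s *\<^sub>R z\<close> as
    \<open>- x\<close> plus \<open>x + s *\<^sub>R z\<close>.\<close>
  proof (rule bdd_belowI2)
    fix s :: real assume "s \<in> {0..}"
    then show "- p (- x) \<le> p (x + s *\<^sub>R z) - s * p z"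
      using norm_sublinearD(1)[OF assms(1), of "- x" "x + s *\<^sub>R z"]
        norm_sublinearD(2)[OF assms(1), of s z] by simp
  qed
qed (use assms in auto)

lemma le_sublinear_shift:
  assumes "\<And>t. 0 \<le> t \<Longrightarrow> m \<le> p (x + t *\<^sub>R z) - t * p z"
  shows "m \<le> sublinear_shift p z x"
  unfolding sublinear_shift_def by (rule cINF_greatest) (use assms in auto)

lemma sublinear_shift_below:
  assumes "norm_sublinear p"
  shows "sublinear_shift p z x \<le> p x"
  using sublinear_shift_le[OF assms, of 0 z x] by simp

lemma norm_sublinear_shift:
  assumes "norm_sublinear p"
  shows "norm_sublinear (sublinear_shift p z)"
  unfolding norm_sublinear_def
proof (intro conjI allI impI)
  let ?q = "sublinear_shift p z"
  show "?q (x + y) \<le> ?q x + ?q y" for x y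
  proof -
    have *: "?q (x + y) \<le> p (x + s *\<^sub>R z) - s * p z + (p (y + t *\<^sub>R z) - t * p z)"
      if "0 \<le> s" "0 \<le> t" for s t
    proof -
      have "?q (x + y) \<le> p ((x + s *\<^sub>R z) + (y + t *\<^sub>R z)) - (s + t) * p z"
        using sublinear_shift_le[OF assms, of "s + t" z "x + y"] that
        by (simp add: algebra_simps)
      also have "\<dots> \<le> p (x + s *\<^sub>R z) + p (y + t *\<^sub>R z) - (s + t) * p z"
        using norm_sublinearD(1)[OF assms] by simp
      finally show ?thesis
        by (simp add: algebra_simps)
    qed
    \<comment> \<open>The two infima are taken one after the other: first over the parameter for
      \<open>x\<close> with \<open>t\<close> fixed, then over \<open>t\<close>.\<close>
    have "?q (x + y) - ?q x \<le> ?q y"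
    proof (rule le_sublinear_shift)
      fix t :: real assume t: "0 \<le> t"
      have "?q (x + y) - (p (y + t *\<^sub>R z) - t * p z) \<le> ?q x"
        by (rule le_sublinear_shift) (use *[OF _ t] in \<open>force simp: algebra_simps\<close>)
      then show "?q (x + y) - ?q x \<le> p (y + t *\<^sub>R z) - t * p z"
        by simp
    qed
    then show ?thesis by simp
  qed
  show "?q (c *\<^sub>R x) \<le> c * ?q x" if "0 \<le> c" for c x
  proof (cases "c = 0")
    case True
    then show ?thesis
      using sublinear_shift_below[OF assms, of z 0] norm_sublinearD(3)[OF assms, of 0] by simp
  next
    case False
    \<comment> \<open>The parameter \<open>c * t\<close> at the point \<open>c *\<^sub>R x\<close>
      corresponds to the parameter \<open>t\<close> at \<open>x\<close>.\<close>
    have "inverse c * ?q (c *\<^sub>R x) \<le> ?q x"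
    proof (rule le_sublinear_shift)
      fix t :: real assume t: "0 \<le> t"
      have "?q (c *\<^sub>R x) \<le> p (c *\<^sub>R (x + t *\<^sub>R z)) - (c * t) * p z"
        using sublinear_shift_le[OF assms, of "c * t" z "c *\<^sub>R x"] that t
        by (simp add: algebra_simps)
      also have "\<dots> = c * (p (x + t *\<^sub>R z) - t * p z)"
        by (simp only: norm_sublinearD(2)[OF assms that]) (simp add: algebra_simps)
      finally show "inverse c * ?q (c *\<^sub>R x) \<le> p (x + t *\<^sub>R z) - t * p z"
        using False that by (simp add: field_simps)
    qed
    then show ?thesis
      using False that by (simp add: field_simps)
  qed
  show "?q x \<le> norm x" for x
    using sublinear_shift_below[OF assms] norm_sublinearD(3)[OF assms] order_trans by blast
qed

text \<open>This supplies the bound for Zorn's lemma. A pointwise infimum of sublinear functionals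
  is in general not subadditive; in a chain it is, because any two members can be replaced by the
  smaller one.\<close>

lemma norm_sublinear_Inf_chain:
  assumes "C \<noteq> {}" and sub: "\<And>p. p \<in> C \<Longrightarrow> norm_sublinear p"
    and chain: "\<And>p q. p \<in> C \<Longrightarrow> q \<in> C \<Longrightarrow> p \<le> q \<or> q \<le> p"
  shows "norm_sublinear (\<lambda>x. INF p\<in>C. p x)"
    and "p \<in> C \<Longrightarrow> (INF p\<in>C. p x) \<le> p x"
proof -
  let ?u = "\<lambda>x. INF p\<in>C. p x"
  have "bdd_below ((\<lambda>p. p x) ` C)" for x
    by (rule bdd_belowI2[of _ "- norm x"]) (use sub norm_sublinearD(5) in blast)
  then show lower: "?u x \<le> p x" if "p \<in> C" for p x
    using that by (intro cINF_lower)
  obtain p\<^sub>0 where p\<^sub>0: "p\<^sub>0 \<in> C"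
    using assms(1) by blast
  show "norm_sublinear ?u"
    unfolding norm_sublinear_def
  proof (intro conjI allI impI)
    show "?u (x + y) \<le> ?u x + ?u y" for x y
    proof -
      have *: "?u (x + y) \<le> p x + q y" if pq: "p \<in> C" "q \<in> C" for p q
      proof -
        obtain r where r: "r \<in> C" "r \<le> p" "r \<le> q"
          using chain[OF pq] pq by blast
        have "?u (x + y) \<le> r (x + y)"
          by (rule lower[OF r(1)])
        also have "\<dots> \<le> r x + r y"
          by (rule norm_sublinearD(1)[OF sub[OF r(1)]])
        also have "\<dots> \<le> p x + q y"
          using r by (simp add: le_fun_def add_mono)
        finally show ?thesis .
      qed
      have "?u (x + y) - ?u x \<le> ?u y"
      proof (rule cINF_greatest[OF assms(1)])
        fix q assume q: "q \<in> C"
        have "?u (x + y) - q y \<le> ?u x"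
          by (rule cINF_greatest[OF assms(1)]) (use *[OF _ q] in \<open>simp add: algebra_simps\<close>)
        then show "?u (x + y) - ?u x \<le> q y"
          by simp
      qed
      then show ?thesis by simp
    qed
    show "?u (c *\<^sub>R x) \<le> c * ?u x" if c: "0 \<le> c" for c x
    proof (cases "c = 0")
      case True
      then show ?thesis
        using lower[OF p\<^sub>0, of 0] norm_sublinearD(3)[OF sub[OF p\<^sub>0], of 0] by simp
    next
      case False
      have "inverse c * ?u (c *\<^sub>R x) \<le> ?u x"
      proof (rule cINF_greatest[OF assms(1)])
        fix p assume p: "p \<in> C"
        then show "inverse c * ?u (c *\<^sub>R x) \<le> p x"
          using lower[OF p, of "c *\<^sub>R x"] norm_sublinearD(2)[OF sub[OF p] c, of x] False c
          by (simp add: field_simps)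
      qed
      then show ?thesis
        using False c by (simp add: field_simps)
    qed
    show "?u x \<le> norm x" for x
      using lower[OF p\<^sub>0] norm_sublinearD(3)[OF sub[OF p\<^sub>0]] order_trans by blast
  qed
qed

text \<open>A minimal \<open>p\<close> equals its own shift along every \<open>z\<close>, and the
  parameter 1 in that shift gives the reverse of subadditivity. Additivity then extends homogeneity
  to negative scalars.\<close>

lemma linear_minimal_norm_sublinear:
  assumes p: "norm_sublinear p"
    and minimal: "\<And>q. norm_sublinear q \<Longrightarrow> q \<le> p \<Longrightarrow> q = p"
  shows "linear p"
proof
  show add: "p (x + z) = p x + p z" for x z
  proof -
    have "sublinear_shift p z = p"
      by (rule minimal) (auto simp: le_fun_def norm_sublinear_shift sublinear_shift_below p)
    then have "p x \<le> p (x + z) - p z"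
      using sublinear_shift_le[OF p, of 1 z x] by simp
    with norm_sublinearD(1)[OF p, of x z] show ?thesis
      by simp
  qed
  have "p 0 = 0"
    using norm_sublinearD(2)[OF p, of 0 0] by simp
  then have neg: "p (- x) = - p x" for x
    using add[of x "- x"] by simp
  show "p (c *\<^sub>R x) = c *\<^sub>R p x" for c x
  proof (cases "0 \<le> c")
    case False
    then show ?thesis
      using norm_sublinearD(2)[OF p, of "- c" x] neg[of "c *\<^sub>R x"] by simp
  qed (simp add: norm_sublinearD(2)[OF p])
qed

text \<open>
  Hahn--Banach in its simplest form: a minimal sublinear functional below the norm is linear, and
  shifting the norm along \<open>x\<^sub>0\<close> before minimizing forces the value at \<open>x\<^sub>0\<close>.
\<close>

lemma norming_functional_exists:
  fixes x\<^sub>0 :: "'a::real_normed_vector"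
  obtains \<phi> :: "'a \<Rightarrow> real" where "linear \<phi>" "\<And>x. \<bar>\<phi> x\<bar> \<le> norm x" "\<phi> x\<^sub>0 = norm x\<^sub>0"
proof -
  \<comment> \<open>For linear \<open>p\<close> the condition at \<open>- x\<^sub>0\<close> says
    \<open>p x\<^sub>0 \<ge> norm x\<^sub>0\<close>. It is an upper bound, so it passes to every
    smaller functional, and a minimal element of \<open>A\<close> is minimal among all sublinear
    functionals below the norm.\<close>
  define A where "A = {p. norm_sublinear p \<and> p (- x\<^sub>0) \<le> - norm x\<^sub>0}"
  have norm: "norm_sublinear (norm :: 'a \<Rightarrow> real)"
    by (simp add: norm_sublinear_def norm_triangle_ineq)
  have "sublinear_shift norm x\<^sub>0 (- x\<^sub>0) \<le> - norm x\<^sub>0"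
    using sublinear_shift_le[OF norm, of 1 x\<^sub>0 "- x\<^sub>0"] by simp
  then have A: "sublinear_shift norm x\<^sub>0 \<in> A"
    by (simp add: A_def norm norm_sublinear_shift)
  \<comment> \<open>Zorn's lemma is applied to the reversed order, so its maximal element is a
    pointwise minimal functional.\<close>
  have "\<exists>m\<in>A. \<forall>q\<in>A. m \<ge> q \<longrightarrow> q = m"
  proof (rule predicate_Zorn)
    show "partial_order_on A (relation_of (\<ge>) A)"
      by (rule partial_order_on_relation_ofI) auto
    fix C assume C: "C \<in> Chains (relation_of (\<ge>) A)"
    then have CA: "C \<subseteq> A"
      by (rule Chains_relation_of)
    have chain: "p \<le> q \<or> q \<le> p" if "p \<in> C" "q \<in> C" for p q
      using C that unfolding Chains_def relation_of_def by blast
    show "\<exists>u\<in>A. \<forall>p\<in>C. p \<ge> u"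
    proof (cases "C = {}")
      case False
      have sub: "norm_sublinear p" if "p \<in> C" for p
        using CA that by (auto simp: A_def)
      note Inf = norm_sublinear_Inf_chain[OF False sub chain]
      obtain p where p: "p \<in> C"
        using False by blast
      have "(INF p\<in>C. p (- x\<^sub>0)) \<le> p (- x\<^sub>0)"
        using Inf(2)[OF _ _ _ p] by blast
      also have "\<dots> \<le> - norm x\<^sub>0"
        using CA p by (auto simp: A_def)
      finally have "(\<lambda>x. INF p\<in>C. p x) \<in> A"
        using Inf(1) by (simp add: A_def)
      then show ?thesis
        using Inf(2) by (intro bexI) (auto simp: le_fun_def)
    qed (use A in auto)
  qed
  then obtain \<phi> where \<phi>: "norm_sublinear \<phi>" "\<phi> (- x\<^sub>0) \<le> - norm x\<^sub>0"
    and minimal: "\<And>q. q \<in> A \<Longrightarrow> q \<le> \<phi> \<Longrightarrow> q = \<phi>"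
    by (auto simp: A_def)
  have lin: "linear \<phi>"
  proof (rule linear_minimal_norm_sublinear[OF \<phi>(1)])
    fix q assume q: "norm_sublinear q" "q \<le> \<phi>"
    then have "q (- x\<^sub>0) \<le> - norm x\<^sub>0"
      using \<phi>(2) order_trans by (auto simp: le_fun_def)
    with q show "q = \<phi>"
      by (intro minimal) (auto simp: A_def)
  qed
  have bound: "\<bar>\<phi> x\<bar> \<le> norm x" for x
    using norm_sublinearD(3,5)[OF \<phi>(1), of x] by linarith
  moreover have "\<phi> x\<^sub>0 = norm x\<^sub>0"
    using \<phi>(2) linear_neg[OF lin, of x\<^sub>0] bound[of x\<^sub>0] by simp
  ultimately show ?thesis
    using lin that by blast
qed

section \<open>Operator norms\<close>

lemma is_normD:
  assumes "is_norm N"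
  shows "0 \<le> N x" "N x = 0 \<longleftrightarrow> x = 0" "N (c *\<^sub>R x) = \<bar>c\<bar> * N x" "N (x + y) \<le> N x + N y"
  using assms by (simp_all add: is_norm_def)

lemma is_norm_norm: "is_norm norm"
  by (simp add: is_norm_def norm_triangle_ineq)

lemma bdd_above_opnorm:
  assumes "is_norm NX" "bounded_operator NX NY T"
  shows "bdd_above ((\<lambda>x. NY (T x)) ` {x. NX x \<le> 1})"
proof -
  obtain K where K: "NY (T x) \<le> K * NX x" for x
    using assms(2) by (auto simp: bounded_operator_def)
  have "NY (T x) \<le> \<bar>K\<bar>" if "NX x \<le> 1" for x
  proof -
    have "K * NX x \<le> \<bar>K\<bar> * 1"
      using that is_normD(1)[OF assms(1)] by (intro mult_mono) auto
    with K[of x] show ?thesis by simp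
  qed
  then show ?thesis
    by (intro bdd_aboveI2) auto
qed

lemma opnorm_upper:
  assumes "is_norm NX" "is_norm NY" "bounded_operator NX NY T"
  shows "NY (T x) \<le> opnorm NX NY T * NX x"
proof (cases "x = 0")
  case True
  have "T 0 = 0"
    using assms(3) by (simp add: bounded_operator_def linear_0)
  with True show ?thesis
    using is_normD(2)[OF assms(1), of 0] is_normD(2)[OF assms(2), of 0] by simp
next
  case False
  then have pos: "0 < NX x"
    using is_normD(1,2)[OF assms(1), of x] by linarith
  have "NY (T (inverse (NX x) *\<^sub>R x)) \<le> opnorm NX NY T"
    unfolding opnorm_def
    by (rule cSUP_upper[OF _ bdd_above_opnorm[OF assms(1,3)]])
      (use pos in \<open>simp add: is_normD(3)[OF assms(1)]\<close>)
  moreover have "T (inverse (NX x) *\<^sub>R x) = inverse (NX x) *\<^sub>R T x"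
    using assms(3) by (simp add: bounded_operator_def linear_scale)
  ultimately show ?thesis
    using pos by (simp add: is_normD(3)[OF assms(2)] field_simps)
qed

lemma opnorm_least:
  assumes "is_norm NX" "\<And>x. NX x \<le> 1 \<Longrightarrow> NY (T x) \<le> K"
  shows "opnorm NX NY T \<le> K"
  unfolding opnorm_def
proof (rule cSUP_least)
  show "{x. NX x \<le> 1} \<noteq> {}"
    using is_normD(2)[OF assms(1), of 0] by (auto intro: exI[of _ 0])
qed (use assms(2) in auto)

lemma opnorm_nearly_attained:
  assumes "is_norm NX" "m < opnorm NX NY T"
  obtains x where "NX x \<le> 1" "m < NY (T x)"
  using opnorm_least[OF assms(1), of NY T m] assms(2) by force

lemma opnorm_pos:
  assumes "is_norm NX" "is_norm NY" "bounded_operator NX NY T" "T \<noteq> (\<lambda>_. 0)"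
  shows "0 < opnorm NX NY T"
proof -
  obtain x where x: "T x \<noteq> 0"
    using assms(4) by auto
  then have "0 < NY (T x)"
    using is_normD(1,2)[OF assms(2), of "T x"] by linarith
  also have "\<dots> \<le> opnorm NX NY T * NX x"
    by (rule opnorm_upper[OF assms(1-3)])
  finally show ?thesis
    using is_normD(1)[OF assms(1), of x] by (simp add: zero_less_mult_iff)
qed

section \<open>Two-dimensional lattices\<close>

lemma two_dim_lattice_mono:
  assumes "two_dim_lattice F" "\<bar>a\<bar> \<le> c" "\<bar>b\<bar> \<le> d"
  shows "F (a, b) \<le> F (c, d)"
proof -
  have N: "is_norm F" and abs: "F (a, b) = F (\<bar>a\<bar>, \<bar>b\<bar>)" for a b
    using assms(1) by (auto simp: two_dim_lattice_def)
  \<comment> \<open>Both steps write a vector as a convex combination of a vector and its mirror image.\<close>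
  have first: "F (a, b) \<le> F (c, b)" if "\<bar>a\<bar> \<le> c" for a b c
  proof (cases "c = 0")
    case False
    with that have c: "0 < c" by linarith
    let ?s = "(1 + a / c) / 2" and ?t = "(1 - a / c) / 2"
    have st: "0 \<le> ?s" "0 \<le> ?t"
      using that c by (auto simp: field_simps abs_le_iff)
    have "(a, b) = ?s *\<^sub>R (c, b) + ?t *\<^sub>R (- c, b)"
      using c by (simp add: field_simps)
    then have "F (a, b) \<le> F (?s *\<^sub>R (c, b)) + F (?t *\<^sub>R (- c, b))"
      using is_normD(4)[OF N] by metis
    also have "\<dots> = ?s * F (c, b) + ?t * F (c, b)"
      unfolding is_normD(3)[OF N] using st abs[of "- c" b] abs[of c b] by simp
    also have "\<dots> = F (c, b)"
      by (simp add: field_simps)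
    finally show ?thesis .
  qed (use that in auto)
  have second: "F (c, b) \<le> F (c, d)" if "\<bar>b\<bar> \<le> d" for b c d
  proof (cases "d = 0")
    case False
    with that have d: "0 < d" by linarith
    let ?s = "(1 + b / d) / 2" and ?t = "(1 - b / d) / 2"
    have st: "0 \<le> ?s" "0 \<le> ?t"
      using that d by (auto simp: field_simps abs_le_iff)
    have "(c, b) = ?s *\<^sub>R (c, d) + ?t *\<^sub>R (c, - d)"
      using d by (simp add: field_simps)
    then have "F (c, b) \<le> F (?s *\<^sub>R (c, d)) + F (?t *\<^sub>R (c, - d))"
      using is_normD(4)[OF N] by metis
    also have "\<dots> = ?s * F (c, d) + ?t * F (c, d)"
      unfolding is_normD(3)[OF N] using st abs[of c "- d"] abs[of c d] by simp
    also have "\<dots> = F (c, d)"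
      by (simp add: field_simps)
    finally show ?thesis .
  qed (use that in auto)
  show ?thesis
    using first[OF assms(2)] second[OF assms(3)] order_trans by blast
qed

lemma two_dim_lattice_components_le:
  assumes "two_dim_lattice F"
  shows "\<bar>fst a\<bar> \<le> F a" "\<bar>snd a\<bar> \<le> F a"
proof -
  have N: "is_norm F" and abs: "F (fst a, snd a) = F (\<bar>fst a\<bar>, \<bar>snd a\<bar>)"
    and unit: "F (1, 0) = 1" "F (0, 1) = 1"
    using assms by (auto simp: two_dim_lattice_def)
  have "F (\<bar>fst a\<bar>, 0) \<le> F a" "F (0, \<bar>snd a\<bar>) \<le> F a"
    using two_dim_lattice_mono[OF assms, of "\<bar>fst a\<bar>" "\<bar>fst a\<bar>" 0 "\<bar>snd a\<bar>"]
      two_dim_lattice_mono[OF assms, of 0 "\<bar>fst a\<bar>" "\<bar>snd a\<bar>" "\<bar>snd a\<bar>"] abs by simp_all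
  moreover have "F (\<bar>fst a\<bar>, 0) = \<bar>fst a\<bar>" "F (0, \<bar>snd a\<bar>) = \<bar>snd a\<bar>"
    using is_normD(3)[OF N, of "\<bar>fst a\<bar>" "(1, 0)"] is_normD(3)[OF N, of "\<bar>snd a\<bar>" "(0, 1)"] unit
    by simp_all
  ultimately show "\<bar>fst a\<bar> \<le> F a" "\<bar>snd a\<bar> \<le> F a"
    by simp_all
qed

text \<open>A crude bound whose purpose is to make the supremum in \<open>dual_norm\<close> one of a
  bounded set.\<close>

lemma inner_le_lattice_norm:
  assumes "two_dim_lattice F"
  shows "\<bar>f \<bullet> a\<bar> \<le> (\<bar>fst f\<bar> + \<bar>snd f\<bar>) * F a"
proof -
  have "\<bar>f \<bullet> a\<bar> \<le> \<bar>fst f\<bar> * \<bar>fst a\<bar> + \<bar>snd f\<bar> * \<bar>snd a\<bar>"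
    by (simp add: inner_prod_def) (metis abs_mult abs_triangle_ineq)
  also have "\<dots> \<le> \<bar>fst f\<bar> * F a + \<bar>snd f\<bar> * F a"
    using two_dim_lattice_components_le[OF assms] by (intro add_mono mult_left_mono) auto
  finally show ?thesis
    by (simp add: algebra_simps)
qed

lemma bounded_operator_inner:
  assumes "two_dim_lattice F"
  shows "bounded_operator F abs (\<lambda>a. f \<bullet> a)"
  unfolding bounded_operator_def
proof (intro conjI exI allI)
  show "linear (\<lambda>a. f \<bullet> a)"
    by (intro linearI) (simp_all add: inner_add_right)
qed (rule inner_le_lattice_norm[OF assms])

text \<open>The dual norm is the operator norm into the reals with \<open>abs\<close>, so the
  general operator bound applies.\<close>

lemma dual_norm_upper:
  assumes "two_dim_lattice F"
  shows "\<bar>f \<bullet> a\<bar> \<le> dual_norm F f * F a"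
proof -
  have "is_norm F" "is_norm (abs :: real \<Rightarrow> real)"
    using assms by (simp_all add: two_dim_lattice_def is_norm_def abs_mult abs_triangle_ineq)
  then show ?thesis
    using opnorm_upper[OF _ _ bounded_operator_inner[OF assms]]
    by (simp add: opnorm_def dual_norm_def)
qed

lemma is_norm_sum_norm:
  assumes "two_dim_lattice F"
  shows "is_norm (sum_norm F)"
  unfolding is_norm_def
proof (intro conjI allI)
  have N: "is_norm F"
    using assms by (simp add: two_dim_lattice_def)
  fix x y :: "'a \<times> 'b" and c :: real
  show "0 \<le> sum_norm F x"
    by (simp add: sum_norm_def is_normD(1)[OF N])
  show "sum_norm F x = 0 \<longleftrightarrow> x = 0"
    by (simp add: sum_norm_def is_normD(2)[OF N] prod_eq_iff)
  show "sum_norm F (c *\<^sub>R x) = \<bar>c\<bar> * sum_norm F x"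
    using is_normD(3)[OF N, of "\<bar>c\<bar>" "(norm (fst x), norm (snd x))"]
    by (simp add: sum_norm_def)
  \<comment> \<open>The triangle inequality in each summand carries over because \<open>F\<close> is
    monotone on nonnegative pairs.\<close>
  have "sum_norm F (x + y) \<le> F ((norm (fst x), norm (snd x)) + (norm (fst y), norm (snd y)))"
    unfolding sum_norm_def plus_prod_def fst_conv snd_conv
    by (rule two_dim_lattice_mono[OF assms]) (auto simp: norm_triangle_ineq)
  also have "\<dots> \<le> sum_norm F x + sum_norm F y"
    unfolding sum_norm_def by (rule is_normD(4)[OF N])
  finally show "sum_norm F (x + y) \<le> sum_norm F x + sum_norm F y" .
qed

section \<open>Rank-one operators on an absolute sum\<close>

lemma dim_range_rank_one:
  fixes \<phi> :: "'x::real_vector \<Rightarrow> real" and y :: "'y::real_vector"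
  assumes "linear \<phi>" "\<phi> x \<noteq> 0" "y \<noteq> 0"
  shows "dim (range (\<lambda>x. \<phi> x *\<^sub>R y)) = 1"
proof -
  have "c *\<^sub>R y \<in> range (\<lambda>x. \<phi> x *\<^sub>R y)" for c
    by (rule range_eqI[of _ _ "(c / \<phi> x) *\<^sub>R x"])
      (use assms in \<open>simp add: linear_scale\<close>)
  then have "range (\<lambda>x. \<phi> x *\<^sub>R y) = span {y}"
    by (auto simp: span_singleton)
  then show ?thesis
    using assms(3) by (simp add: dim_eq_card_independent)
qed

definition sum_functional ::
    "('a \<Rightarrow> real) \<Rightarrow> ('b \<Rightarrow> real) \<Rightarrow> real \<times> real \<Rightarrow> 'a \<times> 'b \<Rightarrow> real" where
  "sum_functional \<phi> \<psi> f x = f \<bullet> (\<phi> (fst x), \<psi> (snd x))"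

text \<open>Since \<phi> and \<psi> attain their norms at \<open>u\<close> and \<open>v\<close>, the
  vectors \<open>(s *\<^sub>R u, t *\<^sub>R v)\<close> form an isometric copy of \<open>F\<close>
  in the sum, on which \<open>sum_functional \<phi> \<psi> f\<close> acts as \<open>f\<close>
  itself.\<close>

locale norming_pair =
  fixes F :: "real \<times> real \<Rightarrow> real"
    and \<phi> :: "'a::real_normed_vector \<Rightarrow> real" and \<psi> :: "'b::real_normed_vector \<Rightarrow> real"
    and u :: 'a and v :: 'b
  assumes lattice: "two_dim_lattice F"
    and linear: "linear \<phi>" "linear \<psi>"
    and bound: "\<And>x. \<bar>\<phi> x\<bar> \<le> norm x" "\<And>x. \<bar>\<psi> x\<bar> \<le> norm x"
    and unit: "norm u = 1" "norm v = 1"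
    and attained: "\<phi> u = 1" "\<psi> v = 1"
begin

lemma linear_sum_functional: "linear (sum_functional \<phi> \<psi> f)"
proof
  show "sum_functional \<phi> \<psi> f (x + y) = sum_functional \<phi> \<psi> f x + sum_functional \<phi> \<psi> f y" for x y
    by (simp add: sum_functional_def linear_add[OF linear(1)] linear_add[OF linear(2)]
        inner_prod_def algebra_simps)
  show "sum_functional \<phi> \<psi> f (c *\<^sub>R x) = c *\<^sub>R sum_functional \<phi> \<psi> f x" for c x
    by (simp add: sum_functional_def linear_scale[OF linear(1)] linear_scale[OF linear(2)]
        inner_prod_def algebra_simps)
qed

text \<open>Keeping the pair of norms on the right is what later places that pair in the slice of
  \<open>w\<close> and compares a rank-one perturbation of the identity with one on
  \<open>F\<close>.\<close>

lemma sum_functional_le: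
  assumes "f \<in> pos_sphere (dual_norm F)"
  shows "\<bar>sum_functional \<phi> \<psi> f x\<bar> \<le> f \<bullet> (norm (fst x), norm (snd x))"
proof -
  have f: "0 \<le> fst f" "0 \<le> snd f"
    using assms by (auto simp: pos_sphere_def)
  have "\<bar>sum_functional \<phi> \<psi> f x\<bar> \<le> fst f * \<bar>\<phi> (fst x)\<bar> + snd f * \<bar>\<psi> (snd x)\<bar>"
    using abs_triangle_ineq[of "fst f * \<phi> (fst x)" "snd f * \<psi> (snd x)"] f
    by (simp add: sum_functional_def inner_prod_def abs_mult)
  also have "\<dots> \<le> fst f * norm (fst x) + snd f * norm (snd x)"
    using f bound by (intro add_mono mult_left_mono) auto
  finally show ?thesis
    by (simp add: inner_prod_def)
qed

lemma sum_functional_bound: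
  assumes "f \<in> pos_sphere (dual_norm F)"
  shows "\<bar>sum_functional \<phi> \<psi> f x\<bar> \<le> sum_norm F x"
proof -
  have "f \<bullet> (norm (fst x), norm (snd x)) \<le> sum_norm F x"
    using dual_norm_upper[OF lattice, of f "(norm (fst x), norm (snd x))"] assms
    by (simp add: pos_sphere_def sum_norm_def)
  with sum_functional_le[OF assms, of x] show ?thesis
    by simp
qed

lemma bounded_operator_rank_one:
  fixes y :: "'y::real_normed_vector"
  assumes "f \<in> pos_sphere (dual_norm F)"
  shows "bounded_operator (sum_norm F) norm (\<lambda>x. sum_functional \<phi> \<psi> f x *\<^sub>R y)"
  unfolding bounded_operator_def
proof (intro conjI exI allI)
  show "linear (\<lambda>x. sum_functional \<phi> \<psi> f x *\<^sub>R y)"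
    using linear_sum_functional[of f]
    by (intro linearI) (simp_all add: linear_add linear_scale scaleR_left_distrib)
  show "norm (sum_functional \<phi> \<psi> f x *\<^sub>R y) \<le> norm y * sum_norm F x" for x
    using sum_functional_bound[OF assms, of x] by (simp add: mult.commute mult_left_mono)
qed

lemma opnorm_rank_one:
  fixes y :: "'y::real_normed_vector"
  assumes "f \<in> pos_sphere (dual_norm F)" "y \<noteq> 0"
  shows "norm y \<le> opnorm (sum_norm F) norm (\<lambda>x. sum_functional \<phi> \<psi> f x *\<^sub>R y)"
proof -
  let ?K = "opnorm (sum_norm F) norm (\<lambda>x. sum_functional \<phi> \<psi> f x *\<^sub>R y)"
  have f: "0 \<le> fst f" "0 \<le> snd f" "dual_norm F f = 1"
    using assms(1) by (auto simp: pos_sphere_def)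
  have N: "is_norm F" and abs: "F (a\<^sub>1, a\<^sub>2) = F (\<bar>a\<^sub>1\<bar>, \<bar>a\<^sub>2\<bar>)" for a\<^sub>1 a\<^sub>2
    using lattice by (auto simp: two_dim_lattice_def)
  have "\<bar>f \<bullet> a\<bar> \<le> ?K / norm y" if "F a \<le> 1" for a
  proof -
    \<comment> \<open>Absolute values make the test vector positive; as \<open>f\<close> is positive
      too, its value there dominates \<open>\<bar>f \<bullet> a\<bar>\<close>.\<close>
    define x where "x = (\<bar>fst a\<bar> *\<^sub>R u, \<bar>snd a\<bar> *\<^sub>R v)"
    have x: "sum_norm F x \<le> 1"
      using that abs[of "fst a" "snd a"] by (simp add: x_def sum_norm_def unit)
    have "\<bar>f \<bullet> a\<bar> \<le> fst f * \<bar>fst a\<bar> + snd f * \<bar>snd a\<bar>"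
      using abs_triangle_ineq[of "fst f * fst a" "snd f * snd a"] f
      by (simp add: inner_prod_def abs_mult)
    also have "\<dots> = sum_functional \<phi> \<psi> f x"
      by (simp add: sum_functional_def x_def linear_scale[OF linear(1)] linear_scale[OF linear(2)]
          attained inner_prod_def)
    finally have "\<bar>f \<bullet> a\<bar> * norm y \<le> norm (sum_functional \<phi> \<psi> f x *\<^sub>R y)"
      by (simp add: mult_right_mono)
    also have "\<dots> \<le> ?K"
      unfolding opnorm_def
      by (rule cSUP_upper[OF _ bdd_above_opnorm[OF is_norm_sum_norm[OF lattice]
              bounded_operator_rank_one[OF assms(1)]]]) (use x in simp)
    finally show ?thesis
      using assms(2) by (simp add: field_simps)
  qed
  then have "dual_norm F f \<le> ?K / norm y"
    using opnorm_least[OF N, of abs "\<lambda>a. f \<bullet> a"] by (simp add: opnorm_def dual_norm_def)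
  then show ?thesis
    using f(3) assms(2) by (simp add: field_simps)
qed

text \<open>Ensures that the operators built from the functional have rank exactly one, as the
  Daugavet equation demands.\<close>

lemma sum_functional_nonzero:
  assumes "f \<in> pos_sphere (dual_norm F)"
  obtains x where "sum_functional \<phi> \<psi> f x \<noteq> 0"
proof -
  have "sum_functional \<phi> \<psi> f \<noteq> (\<lambda>_. 0)"
  proof
    assume "sum_functional \<phi> \<psi> f = (\<lambda>_. 0)"
    then have "opnorm (sum_norm F) norm (\<lambda>x. sum_functional \<phi> \<psi> f x *\<^sub>R (1::real)) \<le> 0"
      by (intro opnorm_least[OF is_norm_sum_norm[OF lattice]]) simp
    with opnorm_rank_one[OF assms, of "1::real"] show False
      by simp
  qed
  with that show ?thesis
    by (meson ext)
qed

section \<open>Consequences of the Daugavet equation on the absolute sum\<close>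

lemma daugavet_center_rank_one:
  fixes G :: "'a \<times> 'b \<Rightarrow> 'y::banach"
  assumes "daugavet_center (sum_norm F) G" "f \<in> pos_sphere (dual_norm F)" "y \<noteq> 0"
  shows "opnorm (sum_norm F) norm G + norm y
           \<le> opnorm (sum_norm F) norm (\<lambda>x. G x + sum_functional \<phi> \<psi> f x *\<^sub>R y)"
proof -
  obtain x where "sum_functional \<phi> \<psi> f x \<noteq> 0"
    using sum_functional_nonzero[OF assms(2)] .
  then have "dim (range (\<lambda>x. sum_functional \<phi> \<psi> f x *\<^sub>R y)) = 1"
    using dim_range_rank_one[OF linear_sum_functional _ assms(3)] by blast
  then have "opnorm (sum_norm F) norm (\<lambda>x. G x + sum_functional \<phi> \<psi> f x *\<^sub>R y) =
      opnorm (sum_norm F) norm G + opnorm (sum_norm F) norm (\<lambda>x. sum_functional \<phi> \<psi> f x *\<^sub>R y)"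
    using bounded_operator_rank_one[OF assms(2)]
    by (intro assms(1)[unfolded daugavet_center_def, THEN conjunct2, THEN conjunct2, rule_format]
        conjI)
  then show ?thesis
    using opnorm_rank_one[OF assms(2,3)] by simp
qed

text \<open>Two quantities of size at most \<open>g\<close> whose sum exceeds
  \<open>2 * g - \<eta> * g\<close> both exceed \<open>(1 - \<eta>) * g\<close>. Here they are the
  norms of the two terms at a point where the perturbed operator nearly attains its norm.\<close>

lemma center_nearly_attained_in_slice:
  fixes G :: "'a \<times> 'b \<Rightarrow> 'y::banach"
  assumes G: "daugavet_center (sum_norm F) G" and w: "w \<in> pos_sphere (dual_norm F)"
    and \<eta>: "0 < \<eta>" "\<eta> < 1"
  obtains x where "sum_norm F x = 1" "1 - \<eta> < w \<bullet> (norm (fst x), norm (snd x))"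
    "(1 - \<eta>) * opnorm (sum_norm F) norm G < norm (G x)"
proof -
  let ?N = "sum_norm F :: 'a \<times> 'b \<Rightarrow> real" and ?n = "\<lambda>x::'a \<times> 'b. (norm (fst x), norm (snd x))"
  define g where "g = opnorm ?N norm G"
  have N: "is_norm ?N"
    by (rule is_norm_sum_norm[OF lattice])
  have bG: "bounded_operator ?N norm G" and "G \<noteq> (\<lambda>_. 0)"
    using G by (auto simp: daugavet_center_def)
  then have g: "0 < g"
    using opnorm_pos[OF N is_norm_norm] by (simp add: g_def)
  have upper: "norm (G x) \<le> g * ?N x" for x
    using opnorm_upper[OF N is_norm_norm bG] by (simp add: g_def)
  obtain x\<^sub>0 where x\<^sub>0: "G x\<^sub>0 \<noteq> 0"
    using \<open>G \<noteq> (\<lambda>_. 0)\<close> by (meson ext)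
  \<comment> \<open>The direction of \<open>y\<close> is arbitrary; the norm \<open>g\<close> gives
    both terms the same upper bound.\<close>
  define y where "y = (g / norm (G x\<^sub>0)) *\<^sub>R G x\<^sub>0"
  have y: "norm y = g" "y \<noteq> 0"
    using x\<^sub>0 g by (auto simp: y_def)
  have "2 * g \<le> opnorm ?N norm (\<lambda>x. G x + sum_functional \<phi> \<psi> w x *\<^sub>R y)"
    using daugavet_center_rank_one[OF G w y(2)] y(1) by (simp add: g_def)
  moreover have "0 < \<eta> * g"
    using \<eta> g by simp
  ultimately have "2 * g - \<eta> * g < opnorm ?N norm (\<lambda>x. G x + sum_functional \<phi> \<psi> w x *\<^sub>R y)"
    by linarith
  then obtain z where z: "?N z \<le> 1" "2 * g - \<eta> * g < norm (G z + sum_functional \<phi> \<psi> w z *\<^sub>R y)"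
    by (rule opnorm_nearly_attained[OF N])
  have "norm (G z + sum_functional \<phi> \<psi> w z *\<^sub>R y) \<le> norm (G z) + \<bar>sum_functional \<phi> \<psi> w z\<bar> * g"
    using norm_triangle_ineq[of "G z" "sum_functional \<phi> \<psi> w z *\<^sub>R y"] y(1) by simp
  with z(2) have sum: "2 * g - \<eta> * g < norm (G z) + \<bar>sum_functional \<phi> \<psi> w z\<bar> * g"
    by linarith
  have Gz: "norm (G z) \<le> g"
    using upper[of z] z(1) g mult_left_le[of "?N z" g] by linarith
  have "\<bar>sum_functional \<phi> \<psi> w z\<bar> \<le> 1"
    using sum_functional_bound[OF w, of z] z(1) by linarith
  then have "\<bar>sum_functional \<phi> \<psi> w z\<bar> * g \<le> g"
    using g by simp
  with sum have large: "(1 - \<eta>) * g < norm (G z)"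
    by (simp add: algebra_simps)
  have "(1 - \<eta>) * g < \<bar>sum_functional \<phi> \<psi> w z\<bar> * g"
    using sum Gz by (simp add: algebra_simps)
  then have slice: "1 - \<eta> < w \<bullet> ?n z"
    using g sum_functional_le[OF w, of z] by simp
  have "0 < (1 - \<eta>) * g"
    using \<eta> g by simp
  then have "0 < g * ?N z"
    using large upper[of z] by linarith
  then have pos: "0 < ?N z"
    using g by (simp add: zero_less_mult_iff)
  \<comment> \<open>The hypothesis on \<open>F\<close> concerns unit vectors only. Scaling up by
    \<open>c \<ge> 1\<close> reaches the sphere and preserves both strict lower bounds.\<close>
  define c where "c = inverse (?N z)"
  have c: "1 \<le> c"
    using pos z(1) by (simp add: c_def one_le_inverse_iff)
  define x where "x = c *\<^sub>R z"
  have "?N x = 1"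
    using pos c by (simp add: x_def is_normD(3)[OF N] c_def)
  moreover have "1 - \<eta> < w \<bullet> ?n x"
  proof -
    have "w \<bullet> ?n x = c * (w \<bullet> ?n z)"
      using c by (simp add: x_def inner_prod_def algebra_simps)
    moreover have "0 < w \<bullet> ?n z"
      using slice \<eta> by linarith
    ultimately show ?thesis
      using slice mult_right_mono[OF c, of "w \<bullet> ?n z"] by linarith
  qed
  moreover have "(1 - \<eta>) * g < norm (G x)"
  proof -
    have "linear G"
      using bG by (simp add: bounded_operator_def)
    then have "norm (G x) = c * norm (G z)"
      using c by (simp add: x_def linear_scale)
    then show ?thesis
      using large c mult_right_mono[of 1 c "norm (G z)"] by simp
  qed
  ultimately show ?thesis
    using that by (simp add: g_def)
qed

text \<open>The triangle inequality in each summand dominates the pair of norms by the image of the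
  pair for \<open>z\<close> under the operator on \<open>F\<close>; monotonicity of \<open>F\<close>
  does the rest.\<close>

lemma sum_norm_add_rank_one_le:
  assumes f: "f \<in> pos_sphere (dual_norm F)" and "sum_norm F z \<le> 1"
  shows "sum_norm F (z + sum_functional \<phi> \<psi> f z *\<^sub>R x)
           \<le> opnorm F F (\<lambda>b. b + (f \<bullet> b) *\<^sub>R (norm (fst x), norm (snd x)))"
proof -
  define a where "a = (norm (fst x), norm (snd x))"
  define b where "b = (norm (fst z), norm (snd z))"
  have N: "is_norm F"
    using lattice by (simp add: two_dim_lattice_def)
  \<comment> \<open>The fresh type variable lets one estimate serve both summands.\<close>
  have comp: "norm (p + sum_functional \<phi> \<psi> f z *\<^sub>R q) \<le> norm p + (f \<bullet> b) * norm q"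
    for p q :: "'c::real_normed_vector"
  proof -
    have "norm (p + sum_functional \<phi> \<psi> f z *\<^sub>R q) \<le> norm p + \<bar>sum_functional \<phi> \<psi> f z\<bar> * norm q"
      using norm_triangle_ineq[of p "sum_functional \<phi> \<psi> f z *\<^sub>R q"] by simp
    also have "\<dots> \<le> norm p + (f \<bullet> b) * norm q"
      using sum_functional_le[OF f, of z] by (intro add_left_mono mult_right_mono) (auto simp: b_def)
    finally show ?thesis .
  qed
  have "sum_norm F (z + sum_functional \<phi> \<psi> f z *\<^sub>R x)
      \<le> F (norm (fst z) + (f \<bullet> b) * norm (fst x), norm (snd z) + (f \<bullet> b) * norm (snd x))"
    unfolding sum_norm_def by (rule two_dim_lattice_mono[OF lattice]) (simp_all add: comp)
  also have "\<dots> = F (b + (f \<bullet> b) *\<^sub>R a)"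
    by (simp add: a_def b_def)
  also have "\<dots> \<le> opnorm F F (\<lambda>b. b + (f \<bullet> b) *\<^sub>R a)"
    unfolding opnorm_def
  proof (rule cSUP_upper)
    show "b \<in> {b. F b \<le> 1}"
      using assms(2) by (simp add: b_def sum_norm_def)
    have "bounded_operator F F (\<lambda>b. b + (f \<bullet> b) *\<^sub>R a)"
      unfolding bounded_operator_def
    proof (intro conjI exI allI)
      show "linear (\<lambda>b. b + (f \<bullet> b) *\<^sub>R a)"
        by (intro linearI) (simp_all add: inner_add_right algebra_simps)
      show "F (b + (f \<bullet> b) *\<^sub>R a) \<le> (1 + F a) * F b" for b
      proof -
        have "\<bar>f \<bullet> b\<bar> * F a \<le> F b * F a"
          using dual_norm_upper[OF lattice, of f b] f is_normD(1)[OF N, of a]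
          by (intro mult_right_mono) (auto simp: pos_sphere_def)
        then show ?thesis
          using is_normD(4)[OF N, of b "(f \<bullet> b) *\<^sub>R a"] is_normD(3)[OF N, of "f \<bullet> b" a]
          by (simp add: algebra_simps)
      qed
    qed
    then show "bdd_above ((\<lambda>b. F (b + (f \<bullet> b) *\<^sub>R a)) ` {b. F b \<le> 1})"
      by (rule bdd_above_opnorm[OF N])
  qed
  finally show ?thesis
    by (simp add: a_def)
qed

lemma not_daugavet_center:
  fixes G :: "'a \<times> 'b \<Rightarrow> 'y::banach"
  assumes w: "w \<in> pos_sphere (dual_norm F)" "0 < \<delta>"
    and denies: "denies_positive_daugavet F (slice F w \<delta> \<inter> pos_sphere F)"
  shows "\<not> daugavet_center (sum_norm F) G"
proof
  assume G: "daugavet_center (sum_norm F) G"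
  let ?N = "sum_norm F :: 'a \<times> 'b \<Rightarrow> real"
  define g where "g = opnorm ?N norm G"
  have N: "is_norm ?N"
    by (rule is_norm_sum_norm[OF lattice])
  have bG: "bounded_operator ?N norm G" and "G \<noteq> (\<lambda>_. 0)"
    using G by (auto simp: daugavet_center_def)
  then have g: "0 < g"
    using opnorm_pos[OF N is_norm_norm] by (simp add: g_def)
  have upper: "norm (G x) \<le> g * ?N x" for x
    using opnorm_upper[OF N is_norm_norm bG] by (simp add: g_def)
  have lin: "linear G"
    using bG by (simp add: bounded_operator_def)
  obtain \<epsilon> where \<epsilon>: "0 < \<epsilon>"
    and small: "\<And>a. a \<in> slice F w \<delta> \<inter> pos_sphere F \<Longrightarrow>
      \<exists>f\<in>pos_sphere (dual_norm F). opnorm F F (\<lambda>b. b + (f \<bullet> b) *\<^sub>R a) < 2 - \<epsilon>"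
    using denies unfolding denies_positive_daugavet_def by blast
  \<comment> \<open>The bound \<delta> puts the pair of norms into the slice, \<epsilon> yields the
    final contradiction, and 1/2 keeps \<open>1 - \<eta>\<close> positive, so that
    \<open>G x\<close> is nonzero.\<close>
  define \<eta> where "\<eta> = min (1 / 2) (min \<delta> \<epsilon>)"
  have \<eta>: "0 < \<eta>" "\<eta> < 1" "\<eta> \<le> \<delta>" "\<eta> \<le> \<epsilon>"
    using \<epsilon> w(2) by (auto simp: \<eta>_def)
  obtain x where x: "?N x = 1" "1 - \<eta> < w \<bullet> (norm (fst x), norm (snd x))" "(1 - \<eta>) * g < norm (G x)"
    using center_nearly_attained_in_slice[OF G w(1) \<eta>(1,2)] by (auto simp: g_def)
  define a where "a = (norm (fst x), norm (snd x))"
  have "a \<in> slice F w \<delta> \<inter> pos_sphere F"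
    using x \<eta> by (auto simp: a_def slice_def pos_sphere_def sum_norm_def)
  then obtain f where f: "f \<in> pos_sphere (dual_norm F)"
    "opnorm F F (\<lambda>b. b + (f \<bullet> b) *\<^sub>R a) < 2 - \<epsilon>"
    using small by blast
  let ?h = "sum_functional \<phi> \<psi> f"
  have "0 < (1 - \<eta>) * g"
    using \<eta> g by simp
  then have "G x \<noteq> 0"
    using x(3) by auto
  then have "g + norm (G x) \<le> opnorm ?N norm (\<lambda>z. G z + ?h z *\<^sub>R G x)"
    using daugavet_center_rank_one[OF G f(1)] by (simp add: g_def)
  also have "\<dots> \<le> g * (2 - \<epsilon>)"
  proof (rule opnorm_least[OF N])
    fix z assume z: "?N z \<le> 1"
    have "norm (G z + ?h z *\<^sub>R G x) = norm (G (z + ?h z *\<^sub>R x))"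
      by (simp add: linear_add[OF lin] linear_scale[OF lin])
    also have "\<dots> \<le> g * ?N (z + ?h z *\<^sub>R x)"
      by (rule upper)
    also have "\<dots> \<le> g * (2 - \<epsilon>)"
      using sum_norm_add_rank_one_le[OF f(1) z, of x] f(2) g
      by (intro mult_left_mono) (auto simp: a_def)
    finally show "norm (G z + ?h z *\<^sub>R G x) \<le> g * (2 - \<epsilon>)" .
  qed
  finally have "g + norm (G x) \<le> g * (2 - \<epsilon>)" .
  \<comment> \<open>The lower bound for \<open>norm (G x)\<close> makes the left side exceed
    \<open>(2 - \<eta>) * g\<close>, which is at least \<open>(2 - \<epsilon>) * g\<close>.\<close>
  moreover have "\<eta> * g \<le> \<epsilon> * g"
    using \<eta> g by simp
  ultimately show False
    using x(3) by (simp add: algebra_simps)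
qed

end

lemma exists_unit_vector:
  assumes "(UNIV :: 'a::real_normed_vector set) \<noteq> {0}"
  obtains u :: "'a::real_normed_vector" where "norm u = 1"
proof -
  obtain x :: 'a where "x \<noteq> 0"
    using assms by auto
  then have "norm (inverse (norm x) *\<^sub>R x) = 1"
    by simp
  then show ?thesis
    by (rule that)
qed

theorem lemma3p6:
  fixes F :: "real \<times> real \<Rightarrow> real"
  assumes "two_dim_lattice F"
    and "\<exists>w\<in>pos_sphere (dual_norm F). \<exists>\<delta>>0.
           denies_positive_daugavet F (slice F w \<delta> \<inter> pos_sphere F)"
    and "(UNIV :: 'a::banach set) \<noteq> {0}"
    and "(UNIV :: 'b::banach set) \<noteq> {0}"
  shows "\<not> daugavet_domain_into TYPE('y::banach) (sum_norm F :: 'a \<times> 'b \<Rightarrow> real)"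
proof -
  obtain u :: 'a where u: "norm u = 1"
    using exists_unit_vector[OF assms(3)] .
  obtain v :: 'b where v: "norm v = 1"
    using exists_unit_vector[OF assms(4)] .
  obtain \<phi> where \<phi>: "linear \<phi>" "\<And>x. \<bar>\<phi> x\<bar> \<le> norm x" "\<phi> u = norm u"
    using norming_functional_exists[of u] by blast
  obtain \<psi> where \<psi>: "linear \<psi>" "\<And>x. \<bar>\<psi> x\<bar> \<le> norm x" "\<psi> v = norm v"
    using norming_functional_exists[of v] by blast
  interpret norming_pair F \<phi> \<psi> u v
    using assms(1) \<phi>(1) \<psi>(1) \<phi>(2) \<psi>(2) u v \<phi>(3)[unfolded u] \<psi>(3)[unfolded v]
    by (rule norming_pair.intro)
  obtain w \<delta> where w: "w \<in> pos_sphere (dual_norm F)" "0 < \<delta>"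
    "denies_positive_daugavet F (slice F w \<delta> \<inter> pos_sphere F)"
    using assms(2) by blast
  show ?thesis
    by (simp add: daugavet_domain_into_def not_daugavet_center[OF w])
qed

end
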